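(* Let $p$ be an odd prime and let $a,b,c$ be integers with $0<a,b,c<p$ such that $$a+c\le p-1,\qquad a+b+c\ge p-1.$$ Then the following hold in $\mathbb F_p$. (i) If $b+c\le p-1$, then $$\bar S(a,b,c;1,1)=\frac{(2c)!}{c!}\,\frac{a!\,(a+c)!\,b!\,(b+c)!}{(a+b+c-p+1)!\,(a+b+2c-p+1)!},$$ and this expression is non-zero if and only if $2c<p$. (ii) If $b+c\ge p$ and $a+b+2c\ge 2p-1$, then $$\bar S(a,b,c;1,1)=\frac{(2c)!}{c!}\,\frac{a!\,(a+c)!\,b!\,(b+c-p)!}{(a+b+c-p+1)!\,(a+b+2c-2p+1)!},$$ and this expression is non-zero if and only if $2c<p$. (iii) If $b+c\ge p$ and $a+b+2c\le 2p-2$, then $\bar S(a,b,c;1,1)=0$.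
   Context: For non-negative integers $a,b,c$ let $\Phi(x_1,x_2;a,b,c)=(x_1-x_2)^{2c}\,x_1^a x_2^a(1-x_1)^b(1-x_2)^b\in\mathbb Z[x_1,x_2]$. For positive integers $l_1,l_2$, let $S(a,b,c;l_1,l_2)\in\mathbb Z$ be the coefficient of $x_1^{l_1p-1}x_2^{l_2p-1}$ in $\Phi(x_1,x_2;a,b,c)$, and let $\bar S(a,b,c;l_1,l_2)\in\mathbb F_p$ be its reduction modulo $p$. Factorials are factorials of non-negative integers, projected to $\mathbb F_p$, and quotients are taken in $\mathbb F_p$. *)

theory Defs
  imports
    "HOL-Computational_Algebra.Polynomial"
    "Berlekamp_Zassenhaus.Finite_Field"
begin

text \<open>
  The ring \<open>\<int>[x\<^sub>1, x\<^sub>2]\<close> is \<open>\<int>[x\<^sub>1][x\<^sub>2]\<close>, the type \<open>int poly poly\<close>: the outer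
  variable is \<open>x\<^sub>2\<close>, the inner one \<open>x\<^sub>1\<close>.
\<close>

definition x1 :: "int poly poly" where
  "x1 = [:[:0, 1:]:]"

definition x2 :: "int poly poly" where
  "x2 = [:0, 1:]"

definition Phi :: "nat \<Rightarrow> nat \<Rightarrow> nat \<Rightarrow> int poly poly" where
  "Phi a b c = (x1 - x2) ^ (2 * c) * x1 ^ a * x2 ^ a * (1 - x1) ^ b * (1 - x2) ^ b"

definition coeff_x1_x2 :: "int poly poly \<Rightarrow> nat \<Rightarrow> nat \<Rightarrow> int" where
  "coeff_x1_x2 P i j = coeff (coeff P j) i"

text \<open>Only used for positive \<open>p\<close>, \<open>l1\<close>, \<open>l2\<close>, so that the subtractions do not truncate.\<close>

definition S :: "nat \<Rightarrow> nat \<Rightarrow> nat \<Rightarrow> nat \<Rightarrow> nat \<Rightarrow> nat \<Rightarrow> int" where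
  "S p a b c l1 l2 = coeff_x1_x2 (Phi a b c) (l1 * p - 1) (l2 * p - 1)"

text \<open>
  The field \<open>\<F>\<^sub>p\<close> is \<open>'p mod_ring\<close>, where the class \<open>prime_card\<close> makes \<open>p = CARD('p)\<close>
  a prime number.
\<close>

definition S_bar :: "nat \<Rightarrow> nat \<Rightarrow> nat \<Rightarrow> nat \<Rightarrow> nat \<Rightarrow> 'p::prime_card mod_ring" where
  "S_bar a b c l1 l2 = of_int (S CARD('p) a b c l1 l2)"

text \<open>
  The factorial is taken in \<open>nat\<close> and then projected; the library's polymorphic \<open>fact\<close>
  is not available in positive characteristic.
\<close>

definition fact_Fp :: "nat \<Rightarrow> 'p::prime_card mod_ring" where
  "fact_Fp n = of_nat (fact n)"

end

theory Submission
  imports Defs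
begin

text \<open>
  Put \<open>m = p - 1 - a - c\<close> and \<open>q = b - m\<close>. Expanding \<open>(x\<^sub>1 - x\<^sub>2)\<^bsup>2c\<^esup>\<close>, the coefficient in
  question is \<open>\<Sum>\<^sub>j (-1)\<^bsup>c+j\<^esup> C(2c, c+j) C(b, m-j) C(b, m+j)\<close>, which up to factorials is the symmetric
  form of Dixon's sum, \<open>\<Sum>\<^sub>j (-1)\<^sup>j C(2m, m+j) C(2q, q+j) C(2c, c+j)\<close>. Hence already over the integers
  it equals \<open>(-1)\<^sup>c (2c)! b! (b+c)! / (c! m! q! (m+c)! (q+c)!)\<close>. Wilson's theorem replaces
  \<open>1/m!\<close> and \<open>1/(m+c)!\<close> by \<open>(a+c)!\<close> and \<open>a!\<close> up to sign, and the three cases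
  differ in whether \<open>(b+c)!\<close> and \<open>(q+c)!\<close> are divisible by \<open>p\<close>.
\<close>

section \<open>Reciprocal factorials on the integers\<close>

text \<open>This is 1/Gamma(k+1) at integers. The value 0 at negative arguments makes binomials
  vanish outside their range and lets recurrences hold for every integer, with no side
  conditions.\<close>

definition inv_fact :: "int \<Rightarrow> real" where
  "inv_fact k = (if k < 0 then 0 else 1 / fact (nat k))"

lemma inv_fact_of_nat [simp]: "inv_fact (int n) = 1 / fact n"
  by (simp add: inv_fact_def)

lemma inv_fact_neg [simp]: "k < 0 \<Longrightarrow> inv_fact k = 0"
  by (simp add: inv_fact_def)

lemma inv_fact_rec: "of_int k * inv_fact k = inv_fact (k - 1)"
proof (cases "k > 0")
  case True
  then obtain n where n: "k = int (Suc n)"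
    using zero_less_imp_eq_int by (metis gr0_implies_Suc)
  have "k - 1 = int n" using n by simp
  then show ?thesis
    unfolding n by (simp only: inv_fact_of_nat fact_Suc) simp
qed (auto simp: inv_fact_def)

lemma binomial_eq_inv_fact:
  "real (n choose k) = fact n * inv_fact (int k) * inv_fact (int n - int k)"
proof (cases "k \<le> n")
  case True
  then have "int n - int k = int (n - k)" by simp
  then have "inv_fact (int n - int k) = 1 / fact (n - k)"
    by (simp only: inv_fact_of_nat)
  then show ?thesis using True by (simp add: binomial_fact)
qed (simp add: binomial_eq_0)

section \<open>Dixon's sum\<close>

text \<open>For non-negative parameters this is C(2A,A+j) C(2B,B+j) C(2N,N+j) divided by (2A)! (2B)!
  (2N)!.\<close>

definition dixon_term :: "int \<Rightarrow> int \<Rightarrow> int \<Rightarrow> int \<Rightarrow> real" where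
  "dixon_term A B N j =
     inv_fact (A + j) * inv_fact (A - j) * inv_fact (B + j) * inv_fact (B - j) *
     inv_fact (N + j) * inv_fact (N - j)"

definition dixon_antidiff :: "int \<Rightarrow> int \<Rightarrow> int \<Rightarrow> int \<Rightarrow> real" where
  "dixon_antidiff A B N j =
     inv_fact (A + j - 1) * inv_fact (A - j) * inv_fact (B + j - 1) * inv_fact (B - j) *
     inv_fact (N + j - 1) * inv_fact (N - j)"

text \<open>
  The polynomial identity behind this telescoping relation is
  \<open>2 (A B N + (A + B + N) j\<^sup>2) = (A + j) (B + j) (N + j) + (A - j) (B - j) (N - j)\<close>.
\<close>

lemma dixon_term_step:
  "2 * (of_int (N * (A + N) * (B + N)) * dixon_term A B N j
        - of_int (A + B + N) * dixon_term A B (N - 1) j)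
   = dixon_antidiff A B N j + dixon_antidiff A B N (j + 1)"
proof -
  \<comment> \<open>By \<open>inv_fact_rec\<close>, each of the other three values is a polynomial
    times \<open>dixon_term A B N j\<close>; comparing these polynomials is all that
    remains.\<close>
  have 1: "dixon_term A B (N - 1) j = of_int ((N + j) * (N - j)) * dixon_term A B N j"
  proof -
    have "N - 1 + j = (N + j) - 1" "N - 1 - j = (N - j) - 1" by simp_all
    then show ?thesis
      unfolding dixon_term_def by (simp only: of_int_mult inv_fact_rec[symmetric]) simp
  qed
  have 2: "dixon_antidiff A B N j = of_int ((A + j) * (B + j) * (N + j)) * dixon_term A B N j"
    unfolding dixon_antidiff_def dixon_term_def
    by (simp only: of_int_mult inv_fact_rec[symmetric]) simp
  have 3: "dixon_antidiff A B N (j + 1) = of_int ((A - j) * (B - j) * (N - j)) * dixon_term A B N j"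
  proof -
    have "dixon_antidiff A B N (j + 1) = inv_fact (A + j) * inv_fact ((A - j) - 1) *
      inv_fact (B + j) * inv_fact ((B - j) - 1) * inv_fact (N + j) * inv_fact ((N - j) - 1)"
      unfolding dixon_antidiff_def by (simp add: algebra_simps)
    then show ?thesis
      unfolding dixon_term_def by (simp only: of_int_mult inv_fact_rec[symmetric]) simp
  qed
  show ?thesis
    unfolding 1 2 3 by (simp add: algebra_simps)
qed

text \<open>Creative telescoping in \<open>n\<close>: summing \<open>dixon_term_step\<close> with
  alternating signs yields a first-order recurrence, which the closed form satisfies. The bound
  \<open>L\<close> is independent of \<open>n\<close> so that the range of summation stays fixed
  during the induction.\<close>

lemma dixon_sum:
  assumes "n \<le> L"
  shows "(\<Sum>k\<le>2 * L. (- 1) ^ k * dixon_term (int A) (int B) (int n) (int k - int L)) =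
    (- 1) ^ L * fact (A + B + n) /
      (fact A * fact B * fact n * fact (A + B) * fact (A + n) * fact (B + n))"
  using assms
proof (induction n)
  case 0
  \<comment> \<open>For \<open>n = 0\<close> the factors 1/j! and 1/(-j)! leave only j = 0, that is
    k = L.\<close>
  have "(\<Sum>k\<le>2 * L. (- 1) ^ k * dixon_term (int A) (int B) (int 0) (int k - int L)) =
    (\<Sum>k\<in>{L}. (- 1) ^ k * dixon_term (int A) (int B) (int 0) (int k - int L))"
    by (rule sum.mono_neutral_right) (auto simp: dixon_term_def inv_fact_def)
  also have "\<dots> = (- 1) ^ L * (1 / (fact A * fact B * fact A * fact B))"
    using inv_fact_of_nat[of 0] by (simp add: dixon_term_def)
  finally show ?case by simp
next
  case (Suc n)
  define t where "t N k = (- 1) ^ k * dixon_term (int A) (int B) (int N) (int k - int L)" for N k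
  define h where "h k = (- 1) ^ k * dixon_antidiff (int A) (int B) (int (Suc n)) (int k - int L)" for k
  define c where "c = real (Suc n * (A + Suc n) * (B + Suc n))"
  define d where "d = real (A + B + Suc n)"
  have step: "2 * (c * t (Suc n) k - d * t n k) = h k - h (Suc k)" for k
  proof -
    have eq: "int (Suc k) - int L = (int k - int L) + 1" "int n = int (Suc n) - 1" by simp_all
    have "2 * (c * t (Suc n) k - d * t n k) = (- 1) ^ k * (2 *
      (of_int (int (Suc n) * (int A + int (Suc n)) * (int B + int (Suc n))) *
         dixon_term (int A) (int B) (int (Suc n)) (int k - int L)
       - of_int (int A + int B + int (Suc n)) *
         dixon_term (int A) (int B) (int (Suc n) - 1) (int k - int L)))"
      unfolding t_def c_def d_def eq(2)[symmetric] by (simp add: algebra_simps)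
    \<comment> \<open>The alternating sign turns the sum of two neighbouring values of
      \<open>dixon_antidiff\<close> into a difference.\<close>
    also have "\<dots> = h k - h (Suc k)"
      unfolding dixon_term_step h_def eq(1) by (simp add: algebra_simps)
    finally show ?thesis .
  qed
  have "2 * (c * sum (t (Suc n)) {..2 * L} - d * sum (t n) {..2 * L}) =
        (\<Sum>k\<le>2 * L. 2 * (c * t (Suc n) k - d * t n k))"
    by (simp add: sum_distrib_left sum_subtractf right_diff_distrib)
  also have "\<dots> = h 0 - h (Suc (2 * L))"
    unfolding step by (rule sum_telescope)
  \<comment> \<open>At j = -L and at j = L + 1 one factor is \<open>inv_fact\<close> of n - L, which
    is negative because Suc n \<le> L.\<close>
  also have "\<dots> = 0"
    using Suc.prems by (simp add: h_def dixon_antidiff_def)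
  finally have "c * sum (t (Suc n)) {..2 * L} = d * sum (t n) {..2 * L}"
    by simp
  moreover have "c \<noteq> 0" unfolding c_def of_nat_eq_0_iff by simp
  ultimately have "sum (t (Suc n)) {..2 * L} = d * sum (t n) {..2 * L} / c"
    by (simp add: nonzero_eq_divide_eq mult.commute)
  also have "sum (t n) {..2 * L} = (- 1) ^ L * fact (A + B + n) /
      (fact A * fact B * fact n * fact (A + B) * fact (A + n) * fact (B + n))"
    using Suc by (simp add: t_def)
  also have "d * \<dots> / c = (- 1) ^ L * (d * fact (A + B + n)) /
      (fact A * fact B * (real (Suc n) * fact n) * fact (A + B)
        * (real (A + Suc n) * fact (A + n)) * (real (B + Suc n) * fact (B + n)))"
    unfolding c_def of_nat_mult
    by (simp only: times_divide_eq_right divide_divide_eq_left mult_ac)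
  also have "\<dots> = (- 1) ^ L * fact (A + B + Suc n) /
      (fact A * fact B * fact (Suc n) * fact (A + B) * fact (A + Suc n) * fact (B + Suc n))"
    unfolding d_def by simp
  finally show ?case by (simp add: t_def)
qed

section \<open>The coefficient as a binomial sum and its closed form\<close>

lemma coeff_power_X_mult_power_one_minus_X:
  "coeff ([:0, 1:] ^ i * (1 - [:0, 1:]) ^ b :: 'a :: comm_ring_1 poly) n =
     (if i \<le> n then (- 1) ^ (n - i) * of_nat (b choose (n - i)) else 0)"
proof -
  have "[:0, 1:] ^ i = (monom 1 i :: 'a poly)"
    by (simp add: monom_altdef)
  moreover have "1 - [:0, 1:] = ([:1, - 1:] :: 'a poly)"
    by (simp add: one_pCons)
  moreover have "coeff ([:1, - 1:] ^ b :: 'a poly) k = (- 1) ^ k * of_nat (b choose k)" for k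
  proof (cases "k \<le> b")
    case True
    then show ?thesis by (simp add: coeff_linear_poly_power mult.commute)
  next
    case False
    have "degree ([:1, - 1:] ^ b :: 'a poly) \<le> 1 * b"
      by (rule order_trans[OF degree_power_le]) simp
    then show ?thesis using False by (simp add: coeff_eq_0 binomial_eq_0)
  qed
  ultimately show ?thesis
    by (simp add: coeff_monom_mult)
qed

text \<open>Once (x1 - x2)^(2c) is expanded, each summand is a polynomial in x1 times one in x2, so
  its coefficient is a product of two univariate ones.\<close>

lemma coeff_x1_x2_Phi:
  defines "f \<equiv> \<lambda>b i n. if i \<le> n then (- 1) ^ (n - i) * int (b choose (n - i)) else 0"
  shows "coeff_x1_x2 (Phi a b c) n n' =
    (\<Sum>k\<le>2 * c. (- 1) ^ k * int (2 * c choose k) * f b (a + k) n * f b (a + (2 * c - k)) n')"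
proof -
  define g :: "nat \<Rightarrow> int poly" where "g i = [:0, 1:] ^ i * (1 - [:0, 1:]) ^ b" for i
  define g' :: "nat \<Rightarrow> int poly poly" where "g' i = x2 ^ i * (1 - x2) ^ b" for i
  \<comment> \<open>The x1-part is a constant with respect to the outer variable.\<close>
  have g: "x1 ^ i * (1 - x1) ^ b = [:g i:]" for i
  proof -
    have "1 - x1 = [:1 - [:0, 1:]:]" by (simp add: x1_def one_pCons)
    then show ?thesis by (simp add: x1_def g_def poly_const_pow)
  qed
  have "(x1 - x2) ^ (2 * c) =
      (\<Sum>k\<le>2 * c. of_nat (2 * c choose k) * x1 ^ k * (- x2) ^ (2 * c - k))"
    using binomial_ring[of x1 "- x2" "2 * c"] by simp
  also have "\<dots> = (\<Sum>k\<le>2 * c. [:of_int ((- 1) ^ k * int (2 * c choose k)):] * (x1 ^ k * x2 ^ (2 * c - k)))"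
  proof (rule sum.cong)
    fix k assume "k \<in> {..2 * c}"
    then have "even (2 * c - k) = even k" by simp
    moreover have "smult [:- x:] r = - smult [:x:] r" for x :: int and r
      by (simp flip: smult_minus_left)
    ultimately show "of_nat (2 * c choose k) * x1 ^ k * (- x2) ^ (2 * c - k) =
      [:of_int ((- 1) ^ k * int (2 * c choose k)):] * (x1 ^ k * x2 ^ (2 * c - k))"
      by (cases "even k") (simp_all add: of_nat_poly of_int_poly mult_ac)
  qed simp
  finally have Phi_unfold: "Phi a b c = (\<Sum>k\<le>2 * c. [:of_int ((- 1) ^ k * int (2 * c choose k)):] *
      (x1 ^ k * x2 ^ (2 * c - k))) * x1 ^ a * x2 ^ a * (1 - x1) ^ b * (1 - x2) ^ b"
    by (simp only: Phi_def)
  have "Phi a b c = (\<Sum>k\<le>2 * c. [:of_int ((- 1) ^ k * int (2 * c choose k)):] *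
     ([:g (a + k):] * g' (a + (2 * c - k))))"
    unfolding g[symmetric] g'_def Phi_unfold sum_distrib_right
    by (intro sum.cong refl) (simp only: power_add mult_ac)
  moreover have "coeff (g' i) n' = [:f b i n':]" for i
    unfolding g'_def x2_def coeff_power_X_mult_power_one_minus_X
    by (auto simp: f_def of_nat_poly minus_one_power_iff)
  moreover have "coeff (g i) n = f b i n" for i
    unfolding g_def f_def coeff_power_X_mult_power_one_minus_X by simp
  ultimately show ?thesis
    by (simp add: coeff_x1_x2_def coeff_sum of_int_poly mult_ac)
qed

text \<open>The case distinction is absorbed by \<open>inv_fact\<close>, and d + i in place of d - i
  gives the same sign without truncated subtraction.\<close>

lemma signed_binomial_eq_inv_fact:
  "real_of_int (if i \<le> d then (- 1) ^ (d - i) * int (b choose (d - i)) else 0) =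
     (- 1) ^ (d + i) * fact b * inv_fact (int d - int i) * inv_fact (int b - (int d - int i))"
proof (cases "i \<le> d")
  case True
  then have "(- 1) ^ (d + i) = (- 1 :: real) ^ (d - i)"
    by (simp add: minus_one_power_iff)
  with True show ?thesis
    by (simp add: binomial_eq_inv_fact of_nat_diff)
qed simp

text \<open>Centring the summation at j = k - c gives \<open>dixon_sum\<close> with parameters m, q,
  c. Multiplying out the denominators keeps the identity in the integers, ready for reduction modulo
  p.\<close>

lemma coeff_x1_x2_Phi_closed_form:
  "coeff_x1_x2 (Phi a (m + q) c) (a + c + m) (a + c + m) *
     (fact c * fact m * fact q * fact (m + c) * fact (q + c)) =
   (- 1) ^ c * fact (2 * c) * fact (m + q) * fact (m + q + c)"
  (is "?S * _ = _")
proof -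
  let ?d = "a + c + m" and ?b = "m + q"
  have summand: "real_of_int ((- 1) ^ k * int (2 * c choose k) *
        (if a + k \<le> ?d then (- 1) ^ (?d - (a + k)) * int (?b choose (?d - (a + k))) else 0) *
        (if a + (2 * c - k) \<le> ?d
         then (- 1) ^ (?d - (a + (2 * c - k))) * int (?b choose (?d - (a + (2 * c - k)))) else 0)) =
      fact (2 * c) * (fact ?b)\<^sup>2 *
        ((- 1) ^ k * dixon_term (int m) (int q) (int c) (int k - int c))"
    if "k \<le> 2 * c" for k
  proof -
    have eqs:
      "int ?d - int (a + k) = int m - (int k - int c)"
      "int ?b - (int m - (int k - int c)) = int q + (int k - int c)"
      "int ?d - int (a + (2 * c - k)) = int m + (int k - int c)"
      "int ?b - (int m + (int k - int c)) = int q - (int k - int c)"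
      "int k = int c + (int k - int c)" "int (2 * c) - int k = int c - (int k - int c)"
      using that by simp_all
    \<comment> \<open>The exponents add up to the even number 2 (?d + a + c), so only the sign from
      (x1 - x2)^(2c) survives.\<close>
    have sign: "(- 1) ^ (?d + (a + k)) * (- 1) ^ (?d + (a + (2 * c - k))) = (1 :: real)"
      using that by (simp flip: power_add)
    have bin: "real (2 * c choose k) = fact (2 * c) *
        inv_fact (int c + (int k - int c)) * inv_fact (int c - (int k - int c))"
      unfolding binomial_eq_inv_fact eqs(6) by simp
    have "?thesis \<longleftrightarrow>
      (- 1) ^ k * real (2 * c choose k) *
        ((- 1) ^ (?d + (a + k)) * fact ?b *
          inv_fact (int m - (int k - int c)) * inv_fact (int q + (int k - int c))) *
        ((- 1) ^ (?d + (a + (2 * c - k))) * fact ?b *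
          inv_fact (int m + (int k - int c)) * inv_fact (int q - (int k - int c))) =
      fact (2 * c) * (fact ?b)\<^sup>2 *
        ((- 1) ^ k * dixon_term (int m) (int q) (int c) (int k - int c))"
      unfolding of_int_mult signed_binomial_eq_inv_fact eqs(1-4) by simp
    also have "\<dots> \<longleftrightarrow>
      ((- 1) ^ (?d + (a + k)) * (- 1) ^ (?d + (a + (2 * c - k)))) *
      (fact (2 * c) * (fact ?b)\<^sup>2 *
        ((- 1) ^ k * dixon_term (int m) (int q) (int c) (int k - int c))) =
      fact (2 * c) * (fact ?b)\<^sup>2 *
        ((- 1) ^ k * dixon_term (int m) (int q) (int c) (int k - int c))"
      unfolding bin dixon_term_def by (simp only: power2_eq_square mult_ac)
    finally show ?thesis unfolding sign by simp
  qed
  have "real_of_int ?S = fact (2 * c) * (fact ?b)\<^sup>2 *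
      (\<Sum>k\<le>2 * c. (- 1) ^ k * dixon_term (int m) (int q) (int c) (int k - int c))"
    unfolding coeff_x1_x2_Phi of_int_sum sum_distrib_left by (intro sum.cong refl summand) simp
  \<comment> \<open>One of the two factors (m+q)! cancels against the (A+B)! in Dixon's
    denominator.\<close>
  then have "real_of_int ?S * (fact c * fact m * fact q * fact (m + c) * fact (q + c)) =
      (- 1) ^ c * fact (2 * c) * fact ?b * fact (?b + c)"
    unfolding dixon_sum[OF order_refl] by (simp add: field_simps power2_eq_square)
  then have "real_of_int (?S * (fact c * fact m * fact q * fact (m + c) * fact (q + c))) =
      real_of_int ((- 1) ^ c * fact (2 * c) * fact ?b * fact (?b + c))"
    by simp
  then show ?thesis by (simp only: of_int_eq_iff)
qed

section \<open>Factorials modulo p\<close>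

lemma of_int_fact_eq_fact_Fp: "of_int (fact n) = fact_Fp n"
  unfolding fact_Fp_def by (metis of_int_of_nat_eq of_nat_fact)

lemma fact_Fp_Suc: "fact_Fp (Suc n) = of_nat (Suc n) * fact_Fp n"
  by (simp only: fact_Fp_def fact_Suc of_nat_mult of_nat_id)

lemma fact_Fp_eq_0_iff:
  "(fact_Fp n :: 'p :: prime_card mod_ring) = 0 \<longleftrightarrow> CARD('p) \<le> n"
  using prime_card[where 'a = 'p]
  by (simp add: fact_Fp_def of_nat_eq_0_iff_char_dvd prime_dvd_fact_iff)

text \<open>Wilson's theorem is the case k = 0. Moving one factor from l! to k! costs a sign, since
  (k+1) + (l+1) = p gives k+1 = -(l+1) in the field.\<close>

lemma fact_Fp_mult_complement:
  assumes "k + l + 1 = CARD('p :: prime_card)"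
  shows "fact_Fp k * fact_Fp l = (- 1 :: 'p mod_ring) ^ (k + 1)"
  using assms
proof (induction k arbitrary: l)
  case 0
  have "[fact (CARD('p) - 1) = - 1] (mod int CARD('p))"
    by (rule wilson_theorem[OF prime_card])
  then have "(of_int (fact (CARD('p) - 1)) :: 'p mod_ring) = of_int (- 1)"
    by (simp only: of_int_eq_iff_cong_CHAR semiring_char_mod_ring)
  then have "(fact_Fp (CARD('p) - 1) :: 'p mod_ring) = - 1"
    by (simp add: of_int_fact_eq_fact_Fp)
  moreover have "CARD('p) - 1 = l" using 0 by simp
  ultimately show ?case by (simp add: fact_Fp_def)
next
  case (Suc k)
  have "Suc k + Suc l = CARD('p)" using Suc.prems by simp
  then have "of_nat (Suc k) + (of_nat (Suc l) :: 'p mod_ring) = of_nat CARD('p)"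
    by (simp only: of_nat_add[symmetric])
  then have "(of_nat (Suc k) :: 'p mod_ring) = - of_nat (Suc l)"
    by (simp only: of_nat_card_eq_0 eq_neg_iff_add_eq_0)
  then have "fact_Fp (Suc k) * fact_Fp l = - (fact_Fp k * fact_Fp (Suc l) :: 'p mod_ring)"
    by (simp only: fact_Fp_Suc mult_minus_left mult_minus_right mult_ac)
  also have "fact_Fp k * fact_Fp (Suc l) = (- 1 :: 'p mod_ring) ^ (k + 1)"
    using Suc.prems by (intro Suc.IH) simp
  finally show ?case by simp
qed

text \<open>Reducing \<open>(p + r)! / p!\<close> modulo \<open>p\<close> gives \<open>r!\<close>, although both factorials vanish.\<close>

lemma fact_card_add:
  obtains N :: int
  where "fact (CARD('p :: prime_card) + r) = fact CARD('p) * N"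
    and "of_int N = (fact_Fp r :: 'p mod_ring)"
proof -
  have "\<exists>N :: int. fact (CARD('p) + r) = fact CARD('p) * N \<and> of_int N = (fact_Fp r :: 'p mod_ring)"
  proof (induction r)
    case 0
    then show ?case by (intro exI[of _ 1]) (simp add: fact_Fp_def)
  next
    case (Suc r)
    then obtain N :: int where
      "fact (CARD('p) + r) = fact CARD('p) * N" "of_int N = (fact_Fp r :: 'p mod_ring)"
      by blast
    then show ?case
      by (intro exI[of _ "int (CARD('p) + Suc r) * N"])
        (simp only: fact_Fp_Suc of_int_mult of_int_of_nat_eq of_nat_add of_nat_card_eq_0
          add_Suc_right fact_Suc, simp add: algebra_simps)
  qed
  with that show ?thesis by blast
qed

section \<open>Reduction modulo p in the three cases\<close>

theorem theorem3p4:
  fixes p a b c :: nat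
  assumes "p = CARD('p::prime_card)" and "odd p"
    and "0 < a" "a < p" "0 < b" "b < p" "0 < c" "c < p"
    and "a + c \<le> p - 1" and "a + b + c \<ge> p - 1"
  shows
    "(b + c \<le> p - 1 \<longrightarrow>
       (let E = (fact_Fp (2 * c) / fact_Fp c) *
                (fact_Fp a * fact_Fp (a + c) * fact_Fp b * fact_Fp (b + c) /
                 (fact_Fp (a + b + c + 1 - p) * fact_Fp (a + b + 2 * c + 1 - p)))
                :: 'p mod_ring
        in S_bar a b c 1 1 = E \<and> (E \<noteq> 0 \<longleftrightarrow> 2 * c < p))) \<and>
     (b + c \<ge> p \<and> a + b + 2 * c \<ge> 2 * p - 1 \<longrightarrow>
       (let E = (fact_Fp (2 * c) / fact_Fp c) *
                (fact_Fp a * fact_Fp (a + c) * fact_Fp b * fact_Fp (b + c - p) /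
                 (fact_Fp (a + b + c + 1 - p) * fact_Fp (a + b + 2 * c + 1 - 2 * p)))
                :: 'p mod_ring
        in S_bar a b c 1 1 = E \<and> (E \<noteq> 0 \<longleftrightarrow> 2 * c < p))) \<and>
     (b + c \<ge> p \<and> a + b + 2 * c \<le> 2 * p - 2 \<longrightarrow>
       S_bar a b c 1 1 = (0 :: 'p mod_ring))"
proof -
  define m where "m = p - 1 - (a + c)"
  define q where "q = a + b + c + 1 - p"
  \<comment> \<open>The two bounds on a + c and a + b + c ensure that neither subtraction
    truncates.\<close>
  have m: "a + c + m = p - 1" and b: "m + q = b"
    using assms by (auto simp: m_def q_def)
  have qc: "a + b + 2 * c + 1 - p = q + c"
    using assms by (auto simp: q_def)
  define s where "s = S p a b c 1 1"
  define F where "F = (fact_Fp :: nat \<Rightarrow> 'p mod_ring)"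
  have S_bar: "S_bar a b c 1 1 = (of_int s :: 'p mod_ring)"
    by (simp add: S_bar_def s_def assms(1))
  have nz: "F n \<noteq> 0 \<longleftrightarrow> n < p" for n
    by (simp add: F_def fact_Fp_eq_0_iff assms(1) not_le)
  have closed: "s * (fact c * fact m * fact q * fact (m + c)) * fact (q + c) =
      (- 1) ^ c * fact (2 * c) * fact b * fact (b + c)"
    using coeff_x1_x2_Phi_closed_form[of a m q c] by (simp add: s_def S_def m b mult_ac)
  have wilson: "F (a + c) * F m = (- 1) ^ (a + c + 1)" "F a * F (m + c) = (- 1) ^ (a + 1)"
    unfolding F_def by (rule fact_Fp_mult_complement; use m assms in simp)+
  \<comment> \<open>Here \<open>y\<close> and \<open>z\<close> stand for (q+c)! and (b+c)!, or for
    their quotients by p! when both are divisible by p.\<close>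
  have reduce: "of_int s * (F c * F q) * of_int y = F (2 * c) * F b * of_int z * (F a * F (a + c))"
    if "s * (fact c * fact m * fact q * fact (m + c)) * y = (- 1) ^ c * fact (2 * c) * fact b * z"
    for y z :: int
  proof -
    have "of_int (s * (fact c * fact m * fact q * fact (m + c)) * y) =
          (of_int ((- 1) ^ c * fact (2 * c) * fact b * z) :: 'p mod_ring)"
      using that by simp
    then have "of_int s * (F c * F m * F q * F (m + c)) * of_int y =
        (- 1) ^ c * F (2 * c) * F b * of_int z"
      by (simp add: of_int_fact_eq_fact_Fp F_def)
    then have "of_int s * (F c * F q) * of_int y * ((F (a + c) * F m) * (F a * F (m + c))) =
        (- 1) ^ c * (F (2 * c) * F b * of_int z * (F a * F (a + c)))"
      by (simp add: mult_ac)
    \<comment> \<open>The two Wilson signs combine to exactly the sign in Dixon's formula, so both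
      cancel.\<close>
    moreover have "(- 1) ^ (a + c + 1) * (- 1) ^ (a + 1) = (- 1 :: 'p mod_ring) ^ c"
      by (simp add: power_add flip: power_mult_distrib)
    ultimately show ?thesis
      unfolding wilson by (simp add: mult.commute[of _ "(- 1) ^ c"])
  qed
  have solve: "x = u / C * (A * B * D * G / (Q * R))"
    if "x * (C * Q) * R = u * D * G * (A * B)" "C \<noteq> 0" "Q \<noteq> 0" "R \<noteq> 0"
    for x u A B C D G Q R :: "'p mod_ring"
  proof -
    have "x = u * D * G * (A * B) / (C * Q * R)"
      using that by (simp add: nonzero_eq_divide_eq mult.assoc)
    then show ?thesis by (simp only: times_divide_times_eq mult_ac)
  qed
  have lt: "c < p" "q < p"
    using assms by (auto simp: q_def)
  have i: "S_bar a b c 1 1 = E \<and> (E \<noteq> 0 \<longleftrightarrow> 2 * c < p)"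
    if "b + c \<le> p - 1"
      and E: "E = F (2 * c) / F c * (F a * F (a + c) * F b * F (b + c) / (F q * F (q + c)))" for E
  proof -
    have le: "q + c < p" "a + c < p" "b + c < p" using assms that by (auto simp: q_def)
    have "of_int s * (F c * F q) * F (q + c) = F (2 * c) * F b * F (b + c) * (F a * F (a + c))"
      using reduce[OF closed] by (simp add: of_int_fact_eq_fact_Fp F_def)
    moreover have "F c \<noteq> 0" "F q \<noteq> 0" "F (q + c) \<noteq> 0"
      using lt le by (simp_all add: nz)
    ultimately have "of_int s = E" unfolding E by (rule solve)
    \<comment> \<open>Every factorial in \<open>E\<close> other than (2c)! has its argument below
      p.\<close>
    moreover have "E \<noteq> 0 \<longleftrightarrow> 2 * c < p"
      unfolding E using lt le assms by (simp add: nz)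
    ultimately show ?thesis unfolding S_bar by simp
  qed
  have ii: "S_bar a b c 1 1 = E \<and> (E \<noteq> 0 \<longleftrightarrow> 2 * c < p)"
    if "b + c \<ge> p" "a + b + 2 * c \<ge> 2 * p - 1"
      and E: "E = F (2 * c) / F c * (F a * F (a + c) * F b * F (b + c - p) /
        (F q * F (a + b + 2 * c + 1 - 2 * p)))" for E
  proof -
    define r where "r = a + b + 2 * c + 1 - 2 * p"
    define r' where "r' = b + c - p"
    have le: "r < p" "a + c < p" "r' < p" and r: "q + c = p + r" "b + c = p + r'"
      using assms that by (auto simp: q_def r_def r'_def)
    obtain y where y: "fact (p + r) = fact p * y" "of_int y = F r"
      unfolding F_def assms(1) by (rule fact_card_add[where 'p = 'p])
    obtain z where z: "fact (p + r') = fact p * z" "of_int z = F r'"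
      unfolding F_def assms(1) by (rule fact_card_add[where 'p = 'p])
    \<comment> \<open>Both (q+c)! and (b+c)! vanish modulo p, so p! has to be cancelled over the
      integers before reducing.\<close>
    have "fact p * (s * (fact c * fact m * fact q * fact (m + c)) * y) =
        fact p * ((- 1) ^ c * fact (2 * c) * fact b * z)"
      using closed unfolding r(1) y(1) r(2) z(1) by (simp only: mult_ac)
    then have "s * (fact c * fact m * fact q * fact (m + c)) * y =
        (- 1) ^ c * fact (2 * c) * fact b * z"
      by (simp only: mult_left_cancel[OF fact_nonzero])
    from reduce[OF this] have "of_int s * (F c * F q) * F r =
        F (2 * c) * F b * F r' * (F a * F (a + c))"
      by (simp only: y z)
    moreover have "F c \<noteq> 0" "F q \<noteq> 0" "F r \<noteq> 0"
      using lt le by (simp_all add: nz)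
    ultimately have "of_int s = E" unfolding E r_def[symmetric] r'_def[symmetric] by (rule solve)
    moreover have "E \<noteq> 0 \<longleftrightarrow> 2 * c < p"
      unfolding E r_def[symmetric] r'_def[symmetric] using lt le assms by (simp add: nz)
    ultimately show ?thesis unfolding S_bar by simp
  qed
  have iii: "S_bar a b c 1 1 = (0 :: 'p mod_ring)"
    if "b + c \<ge> p" "a + b + 2 * c \<le> 2 * p - 2"
  proof -
    \<comment> \<open>Now (q+c)! is still invertible while (b+c)! is zero, which forces the
      coefficient to vanish.\<close>
    have le: "q + c < p" using assms that by (auto simp: q_def)
    have "of_int s * (F c * F q) * F (q + c) = F (2 * c) * F b * F (b + c) * (F a * F (a + c))"
      using reduce[OF closed] by (simp add: of_int_fact_eq_fact_Fp F_def)
    moreover have "F (b + c) = 0" using nz[of "b + c"] that by simp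
    moreover have "F c \<noteq> 0" "F q \<noteq> 0" "F (q + c) \<noteq> 0"
      using lt le by (simp_all add: nz)
    ultimately show ?thesis unfolding S_bar by simp
  qed
  show ?thesis
    unfolding Let_def qc q_def[symmetric] F_def[symmetric]
  proof (rule conjI[OF impI conjI[OF impI impI]], goal_cases)
    case 1
    then show ?case by (rule i[OF _ refl])
  next
    case 2
    then show ?case by (elim conjE) (rule ii[OF _ _ refl])
  next
    case 3
    then show ?case by (elim conjE) (rule iii)
  qed
qed

end
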